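(* Let $P_{(2,0)}$ be the set of all cylindric partitions with profile $c=(2,0)$. Then, as formal power series in $q$, $$\sum_{\Lambda\in P_{(2,0)}} q^{|\Lambda|}=\frac{(-q^2;q^2)_\infty}{(q;q)_\infty}.$$
   Context: Let $r,\ell$ be positive integers and $c=(c_1,\dots,c_r)$ a composition of $\ell$ into $r$ nonnegative integer parts (zero entries allowed). A cylindric partition with profile $c$ is a tuple $\Lambda=(\lambda^{(1)},\dots,\lambda^{(r)})$ of ordinary partitions $\lambda^{(i)}=(\lambda^{(i)}_1\ge\lambda^{(i)}_2\ge\cdots)$ (parts beyond the length are taken to be $0$) such that for all $i,j$: $\lambda^{(i)}_j\ge\lambda^{(i+1)}_{j+c_{i+1}}$ for $1\le i\le r-1$, and $\lambda^{(r)}_j\ge\lambda^{(1)}_{j+c_1}$. The size $|\Lambda|$ is the sum of all parts of all $\lambda^{(i)}$; the empty cylindric partition is included with size $0$. Notation: $(a;q)_n=\prod_{k=1}^n(1-aq^{k-1})$, $(a;q)_\infty=\lim_{n\to\infty}(a;q)_n$. *)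

theory Defs
  imports "HOL-Analysis.Analysis"
begin

definition is_partition :: "nat list \<Rightarrow> bool" where
  "is_partition xs \<longleftrightarrow> sorted_wrt (\<ge>) xs \<and> (\<forall>x\<in>set xs. 0 < x)"

text \<open>Parts, rows and profile entries are all indexed from 0, so \<open>part xs j\<close> is the
  \<open>(j + 1)\<close>-st part; parts beyond the length are 0.\<close>

definition part :: "nat list \<Rightarrow> nat \<Rightarrow> nat" where
  "part xs j = (if j < length xs then xs ! j else 0)"

text \<open>The profile \<open>c\<close> is a list of length \<open>r\<close>. It has to be nonempty, since the last
  clause refers to the first and the last row.\<close>

definition cylindric_partitions :: "nat list \<Rightarrow> nat list list set" where
  "cylindric_partitions c = {\<Lambda>.
     c \<noteq> [] \<and> length \<Lambda> = length c \<and>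
     (\<forall>xs\<in>set \<Lambda>. is_partition xs) \<and>
     (\<forall>i j. i + 1 < length c \<longrightarrow> part (\<Lambda> ! i) j \<ge> part (\<Lambda> ! (i + 1)) (j + c ! (i + 1))) \<and>
     (\<forall>j. part (\<Lambda> ! (length c - 1)) j \<ge> part (\<Lambda> ! 0) (j + c ! 0))}"

definition cp_size :: "nat list list \<Rightarrow> nat" where
  "cp_size \<Lambda> = sum_list (map sum_list \<Lambda>)"

definition qpochhammer :: "'a :: comm_ring_1 \<Rightarrow> 'a \<Rightarrow> nat \<Rightarrow> 'a" where
  "qpochhammer a q n = (\<Prod>k=1..n. 1 - a * q ^ (k - 1))"

text \<open>On \<^typ>\<open>'a fps\<close> the limit is the one for the metric of formal power series, that is,
  coefficientwise stabilisation. It is meaningful only where the limit exists.\<close>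

definition qpochhammer_inf :: "'a :: {comm_ring_1, t2_space} \<Rightarrow> 'a \<Rightarrow> 'a" where
  "qpochhammer_inf a q = lim (\<lambda>n. qpochhammer a q n)"

end

theory Submission
  imports Defs
begin

unbundle no vec_syntax
unbundle fps_syntax

text \<open>A cylindric partition of profile \<open>(2, 0)\<close> is a pair of partitions \<open>f, g\<close> with
  \<open>f\<^sub>j \<ge> g\<^sub>j \<ge> f\<^sub>j\<^sub>+\<^sub>2\<close> (indices from 0). Arrange the entries in the levels \<open>{f\<^sub>0}\<close>,
  \<open>{f\<^sub>1, g\<^sub>0}\<close>, \<open>{f\<^sub>2, g\<^sub>1}\<close>, and so on: the conditions say exactly that every entry of a level
  dominates every entry of the next one, while the two entries of a level are not related.
  Remove the last of \<open>N + 1\<close> two-element levels by subtracting its maximum from all earlier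
  entries. Its two entries have a minimum \<open>m\<close>, contributing \<open>(2N + 3) m\<close> to the size, and a signed
  difference \<open>x\<close>, contributing \<open>(2N + 2) \<bar>x\<bar>\<close>. Hence the level contributes the factor
  \<open>(1 + q\<^sup>k) / ((1 - q\<^sup>k) (1 - q\<^sup>k\<^sup>+\<^sup>1))\<close> with \<open>k = 2N + 2\<close>.\<close>

section \<open>Generating functions of weighted sets\<close>

text \<open>Convergence is coefficientwise and \<open>fps_X ^ w x\<close> touches only the
  coefficient \<open>w x\<close>, so the sum exists iff each weight occurs finitely often. Infinite
  sums thus become counting statements.\<close>

lemma has_sum_fps_X_power_iff:
  fixes F :: "'a :: comm_ring_1 fps"
  shows "((\<lambda>x. fps_X ^ w x) has_sum F) A \<longleftrightarrow>
    (\<forall>n. finite {x\<in>A. w x = n} \<and> F $ n = of_nat (card {x\<in>A. w x = n}))"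
proof -
  have eq: "{x\<in>A. (fps_X ^ w x :: 'a fps) $ n \<noteq> 0} = {x\<in>A. w x = n}" for n
    by (auto simp: fps_X_power_nth)
  have sum_eq: "(\<Sum>x | x \<in> A \<and> w x = n. (fps_X ^ w x :: 'a fps) $ n) = of_nat (card {x\<in>A. w x = n})" for n
    by (simp add: fps_X_power_nth)
  show ?thesis
    using has_sum_fpsI[where F = "\<lambda>x. fps_X ^ w x" and S = F and A = A]
      has_sum_fpsD[where F = "\<lambda>x. fps_X ^ w x" and S = F and A = A]
    unfolding eq sum_eq by blast
qed

text \<open>Splitting the pairs of total weight \<open>n\<close> by the weight \<open>i\<close> of
  the first component gives the Cauchy product of the two counting sequences.\<close>

lemma has_sum_fps_X_power_Times:
  fixes F G :: "'a :: comm_ring_1 fps"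
  assumes F: "((\<lambda>x. fps_X ^ v x) has_sum F) A" and G: "((\<lambda>y. fps_X ^ w y) has_sum G) B"
  shows "((\<lambda>(x, y). fps_X ^ (v x + w y)) has_sum (F * G)) (A \<times> B)"
proof -
  let ?A = "\<lambda>i. {x\<in>A. v x = i}" and ?B = "\<lambda>i. {y\<in>B. w y = i}"
  have fin: "finite (?A i)" "finite (?B i)" for i
    using F G by (simp_all add: has_sum_fps_X_power_iff)
  have eq: "{p \<in> A \<times> B. (\<lambda>(x, y). v x + w y) p = n} = (\<Union>i\<in>{0..n}. ?A i \<times> ?B (n - i))" for n
    by auto
  have "card {p \<in> A \<times> B. (\<lambda>(x, y). v x + w y) p = n} = (\<Sum>i=0..n. card (?A i) * card (?B (n - i)))" for n
    unfolding eq by (subst card_UN_disjoint) (use fin in \<open>auto simp: card_cartesian_product\<close>)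
  then have "((\<lambda>p. fps_X ^ (\<lambda>(x, y). v x + w y) p) has_sum (F * G)) (A \<times> B)"
    using F G fin unfolding has_sum_fps_X_power_iff eq by (auto simp: fps_mult_nth)
  then show ?thesis
    by (simp add: case_prod_unfold)
qed

lemma has_sum_fps_X_geometric:
  assumes "k > 0"
  shows "((\<lambda>m. fps_X ^ (k * m)) has_sum inverse (1 - fps_X ^ k :: 'a :: field fps)) UNIV"
proof -
  \<comment> \<open>The indicator series of the multiples of \<open>k\<close>: subtracting its shift
    by \<open>k\<close> leaves only the constant 1, so it is the inverse.\<close>
  define F :: "'a fps" where "F = Abs_fps (\<lambda>n. if k dvd n then 1 else 0)"
  have "F * (1 - fps_X ^ k) = 1"
  proof (rule fps_ext)
    fix n
    have "k dvd n - k \<longleftrightarrow> k dvd n" if "n \<ge> k"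
      using that by (simp add: dvd_minus_self)
    moreover have "\<not> k dvd n" if "n < k" "n \<noteq> 0"
      using that by (auto dest: dvd_imp_le)
    ultimately show "(F * (1 - fps_X ^ k)) $ n = 1 $ n"
      using assms by (auto simp: F_def algebra_simps fps_X_power_mult_nth)
  qed
  then have "inverse (1 - fps_X ^ k) = F"
    by (metis fps_inverse_unique mult.commute)
  moreover have "{m. k * m = n} = (if k dvd n then {n div k} else {})" for n
    using assms by auto
  ultimately show ?thesis
    by (simp add: has_sum_fps_X_power_iff F_def)
qed

section \<open>Limits of formal power series\<close>

text \<open>Coefficient \<open>n\<close> of a product involves only finitely many coefficients of
  the factors, each of which is eventually constant.\<close>

lemma tendsto_mult_fps:
  fixes f g :: "'b \<Rightarrow> 'a :: ring fps"
  assumes "(f \<longlongrightarrow> a) F" "(g \<longlongrightarrow> b) F"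
  shows "((\<lambda>x. f x * g x) \<longlongrightarrow> a * b) F"
proof (rule tendsto_fpsI)
  fix n
  have "eventually (\<lambda>x. \<forall>i\<in>{0..n}. f x $ i = a $ i \<and> g x $ i = b $ i) F"
    using assms by (intro eventually_ball_finite) (auto simp: tendsto_fps_iff eventually_conj_iff)
  then show "eventually (\<lambda>x. (f x * g x) $ n = (a * b) $ n) F"
    by eventually_elim (simp add: fps_mult_nth)
qed

lemma qpochhammer_0 [simp]: "qpochhammer a q 0 = 1"
  by (simp add: qpochhammer_def)

lemma qpochhammer_Suc: "qpochhammer a q (Suc n) = qpochhammer a q n * (1 - a * q ^ n)"
  by (simp add: qpochhammer_def)

text \<open>The factor with index \<open>n\<close> differs from 1 by a multiple of
  \<open>fps_X ^ Suc n\<close>, so coefficient \<open>i\<close> is fixed from the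
  \<open>i\<close>-th product on. Hence the \<open>lim\<close> in \<open>qpochhammer_inf\<close> is
  a genuine limit.\<close>

lemma tendsto_qpochhammer_inf:
  fixes a q :: "'a :: comm_ring_1 fps"
  assumes "fps_X dvd a" "fps_X dvd q"
  shows "qpochhammer a q \<longlonglongrightarrow> qpochhammer_inf a q"
proof -
  have step: "qpochhammer a q (Suc n) $ i = qpochhammer a q n $ i" if "i \<le> n" for i n
  proof -
    have "fps_X ^ Suc n dvd a * q ^ n"
      using assms by (auto intro!: mult_dvd_mono dvd_power_same)
    then obtain h where "a * q ^ n = fps_X ^ Suc n * h" ..
    then have "qpochhammer a q (Suc n) =
        qpochhammer a q n - fps_X ^ Suc n * (h * qpochhammer a q n)"
      by (simp add: qpochhammer_Suc algebra_simps)
    then show ?thesis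
      using that by (simp add: fps_X_power_mult_nth del: power_Suc)
  qed
  have stable: "qpochhammer a q n $ i = qpochhammer a q i $ i" if "i \<le> n" for i n
    using that by (induction rule: dec_induct) (simp_all add: step)
  have "qpochhammer a q \<longlonglongrightarrow> Abs_fps (\<lambda>i. qpochhammer a q i $ i)"
    by (intro tendsto_fpsI eventually_mono[OF eventually_ge_at_top]) (auto intro: stable)
  then show ?thesis
    unfolding qpochhammer_inf_def by (simp add: limI)
qed

lemma fps_nth_0_qpochhammer:
  assumes "fps_X dvd a"
  shows "qpochhammer a q n $ 0 = 1"
  using assms by (induction n) (auto simp: qpochhammer_Suc elim!: dvdE)

section \<open>Pairs of interlacing sequences\<close>

text \<open>The vanishing conditions keep the singleton level \<open>f 0\<close> and the
  \<open>N\<close> two-element levels \<open>f (Suc j), g j\<close> with \<open>j < N\<close>.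
  Functions on all indices, rather than lists, allow levels to be changed pointwise.\<close>

definition interlacing :: "nat \<Rightarrow> ((nat \<Rightarrow> nat) \<times> (nat \<Rightarrow> nat)) set" where
  "interlacing N = {(f, g). f (Suc N) = 0 \<and> g N = 0 \<and>
     (\<forall>j. f (Suc j) \<le> f j \<and> g (Suc j) \<le> g j \<and> g j \<le> f j \<and> f (Suc (Suc j)) \<le> g j)}"

fun pair_size :: "nat \<Rightarrow> (nat \<Rightarrow> nat) \<times> (nat \<Rightarrow> nat) \<Rightarrow> nat" where
  "pair_size N (f, g) = sum f {..N} + sum g {..<N}"

lemma interlacing_antimono:
  assumes "(f, g) \<in> interlacing N"
  shows "i \<le> j \<Longrightarrow> f j \<le> f i" "i \<le> j \<Longrightarrow> g j \<le> g i"
  using assms by (auto simp: interlacing_def intro: lift_Suc_antimono_le)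

lemma interlacing_eq_0:
  assumes "(f, g) \<in> interlacing N"
  shows "j > N \<Longrightarrow> f j = 0" "j \<ge> N \<Longrightarrow> g j = 0"
  using interlacing_antimono(1)[OF assms, of "Suc N" j] interlacing_antimono(2)[OF assms, of N j] assms
  by (auto simp: interlacing_def)

text \<open>Only \<open>f 0\<close> survives, and it is arbitrary: one geometric series.\<close>

lemma has_sum_interlacing_0:
  "((\<lambda>p. fps_X ^ pair_size 0 p) has_sum inverse (1 - fps_X :: 'a :: field fps)) (interlacing 0)"
proof -
  have "((\<lambda>p. fps_X ^ pair_size 0 p) has_sum inverse (1 - fps_X :: 'a fps)) (interlacing 0) \<longleftrightarrow>
    ((\<lambda>m. fps_X ^ (1 * m)) has_sum inverse (1 - fps_X ^ 1 :: 'a fps)) UNIV"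
  proof (rule has_sum_reindex_bij_witness[where
      i = "\<lambda>m. (\<lambda>j. if j = 0 then m else 0, \<lambda>j. 0)" and j = "\<lambda>(f, g). f 0"])
    fix p assume p: "p \<in> interlacing 0"
    then show "(\<lambda>m. (\<lambda>j. if j = 0 then m else 0, \<lambda>j. 0)) ((\<lambda>(f, g). f 0) p) = p"
      by (cases p) (auto simp: fun_eq_iff interlacing_eq_0)
  qed (auto simp: interlacing_def)
  then show ?thesis
    using has_sum_fps_X_geometric[of 1, where 'a = 'a] by simp
qed

section \<open>Splitting off the last two-element level\<close>

text \<open>Subtraction on naturals truncates: the removed entries and the zeros beyond them become
  0 without a case distinction, while by \<open>level_le\<close> nothing is lost on earlier
  entries.\<close>

definition strip_level :: "nat \<Rightarrow> (nat \<Rightarrow> nat) \<times> (nat \<Rightarrow> nat) \<Rightarrow>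
    ((nat \<Rightarrow> nat) \<times> (nat \<Rightarrow> nat)) \<times> (nat \<times> nat)" where
  "strip_level N = (\<lambda>(f, g). let m = max (f (Suc N)) (g N) in
     ((\<lambda>j. f j - m, \<lambda>j. g j - m), (f (Suc N), g N)))"

definition add_level :: "nat \<Rightarrow> ((nat \<Rightarrow> nat) \<times> (nat \<Rightarrow> nat)) \<times> (nat \<times> nat) \<Rightarrow>
    (nat \<Rightarrow> nat) \<times> (nat \<Rightarrow> nat)" where
  "add_level N = (\<lambda>((f, g), (u, v)).
     (\<lambda>j. if j \<le> N then f j + max u v else if j = Suc N then u else 0,
      \<lambda>j. if j < N then g j + max u v else if j = N then v else 0))"

lemma level_le:
  assumes "(f, g) \<in> interlacing (Suc N)"
  shows "j \<le> N \<Longrightarrow> max (f (Suc N)) (g N) \<le> f j" "j < N \<Longrightarrow> max (f (Suc N)) (g N) \<le> g j"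
proof -
  have *: "g N \<le> f N" "f (Suc (Suc j)) \<le> g j" for j
    using assms by (auto simp: interlacing_def)
  show "max (f (Suc N)) (g N) \<le> f j" if "j \<le> N"
    using interlacing_antimono(1)[OF assms, of j "Suc N"]
      interlacing_antimono(1)[OF assms, of j N] * that by simp
  show "max (f (Suc N)) (g N) \<le> g j" if "j < N"
    using interlacing_antimono(1)[OF assms, of "Suc (Suc j)" "Suc N"]
      interlacing_antimono(2)[OF assms, of j N] *(2)[of j] that by simp
qed

lemma add_level_strip_level:
  assumes "p \<in> interlacing (Suc N)"
  shows "add_level N (strip_level N p) = p"
proof -
  obtain f g where p: "p = (f, g)" by (cases p)
  note le = level_le[OF assms[unfolded p]]
  note zero = interlacing_eq_0[OF assms[unfolded p]]
  have "j \<le> N \<or> j = Suc N \<or> j > Suc N" "j < N \<or> j = N \<or> j \<ge> Suc N" for j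
    by auto
  then show ?thesis
    using le zero by (auto simp: p add_level_def strip_level_def Let_def fun_eq_iff)
qed

lemma strip_level_in:
  assumes "p \<in> interlacing (Suc N)"
  shows "strip_level N p \<in> interlacing N \<times> UNIV"
  using assms by (auto simp: strip_level_def Let_def interlacing_def intro!: diff_le_mono)

lemma strip_level_add_level:
  assumes "t \<in> interlacing N \<times> UNIV"
  shows "strip_level N (add_level N t) = t"
proof -
  obtain f g u v where t: "t = ((f, g), (u, v))" by (cases t) auto
  have "(f, g) \<in> interlacing N" using assms t by simp
  note zero = interlacing_eq_0[OF this]
  show ?thesis
    using zero by (auto simp: t add_level_def strip_level_def Let_def fun_eq_iff)
qed

lemma add_level_in:
  assumes "t \<in> interlacing N \<times> UNIV"
  shows "add_level N t \<in> interlacing (Suc N)"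
proof -
  obtain f g u v where t: "t = ((f, g), (u, v))" by (cases t) auto
  then have "(f, g) \<in> interlacing N" using assms by simp
  then show ?thesis
    by (auto simp: t add_level_def interlacing_def le_Suc_eq less_Suc_eq not_le not_less)
qed

text \<open>The maximum is added to \<open>N + 1\<close> entries of \<open>f\<close> and
  \<open>N\<close> entries of \<open>g\<close>; the new level itself adds
  \<open>u + v\<close>.\<close>

lemma pair_size_add_level:
  "pair_size (Suc N) (add_level N (p, (u, v))) =
    pair_size N p + ((2 * N + 1) * max u v + u + v)"
proof -
  obtain f g where p: "p = (f, g)" by (cases p)
  show ?thesis
    by (simp add: p add_level_def sum.distrib lessThan_Suc atMost_Suc algebra_simps)
qed

text \<open>With \<open>m\<close> the minimum of \<open>u\<close> and \<open>v\<close>, the exponent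
  equals \<open>(2 * N + 3) * m\<close> plus \<open>2 * N + 2\<close> times the distance of
  \<open>u\<close> and \<open>v\<close>. The distance is \<open>d\<close> if
  \<open>u \<ge> v\<close> and \<open>d + 1\<close> if \<open>u < v\<close>, recorded by a
  boolean.\<close>

lemma has_sum_level:
  "((\<lambda>(u, v). fps_X ^ ((2 * N + 1) * max u v + u + v)) has_sum
     (inverse (1 - fps_X ^ (2 * N + 3)) *
       ((1 + fps_X ^ (2 * N + 2)) * inverse (1 - fps_X ^ (2 * N + 2))) :: 'a :: field fps)) UNIV"
proof -
  \<comment> \<open>The boolean is true for \<open>u < v\<close>. The shift to \<open>d + 1\<close>
    counts distance 0 only once and costs one extra \<open>2 * N + 2\<close>, which gives the
    numerator.\<close>
  have "((\<lambda>b. fps_X ^ (if b then 2 * N + 2 else 0)) has_sum (1 + fps_X ^ (2 * N + 2) :: 'a fps)) UNIV"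
    by (intro has_sum_finiteI) (auto simp: UNIV_bool add.commute)
  from has_sum_fps_X_power_Times[OF this has_sum_fps_X_geometric[of "2 * N + 2"]]
  have "((\<lambda>p. fps_X ^ (\<lambda>(b, d). (if b then 2 * N + 2 else 0) + (2 * N + 2) * d) p) has_sum
      ((1 + fps_X ^ (2 * N + 2)) * inverse (1 - fps_X ^ (2 * N + 2)) :: 'a fps)) UNIV"
    by (simp add: case_prod_unfold)
  from has_sum_fps_X_power_Times[OF has_sum_fps_X_geometric[of "2 * N + 3"] this]
  have "((\<lambda>(m, b, d). fps_X ^ ((2 * N + 3) * m + ((if b then 2 * N + 2 else 0) + (2 * N + 2) * d)))
      has_sum (inverse (1 - fps_X ^ (2 * N + 3)) *
       ((1 + fps_X ^ (2 * N + 2)) * inverse (1 - fps_X ^ (2 * N + 2))) :: 'a fps)) UNIV"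
    by (simp add: case_prod_unfold)
  also have "?this \<longleftrightarrow> ?thesis"
    by (rule has_sum_reindex_bij_witness[where
      i = "\<lambda>(u, v). if u < v then (u, True, v - u - 1) else (v, False, u - v)" and
      j = "\<lambda>(m, b, d). if b then (m, m + d + 1) else (m + d, m)"])
      (auto simp: max_def algebra_simps split: if_splits)
  finally show ?thesis .
qed

text \<open>Each level contributes one numerator factor and two consecutive denominator factors;
  with the single factor of level 0 the denominator has \<open>2 * N + 1\<close> factors.\<close>

lemma has_sum_interlacing:
  "((\<lambda>p. fps_X ^ pair_size N p) has_sum
     (qpochhammer (- (fps_X ^ 2)) (fps_X ^ 2) N * inverse (qpochhammer fps_X fps_X (2 * N + 1))
       :: 'a :: field fps)) (interlacing N)"
proof (induction N)
  case 0
  then show ?case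
    using has_sum_interlacing_0 by (simp add: qpochhammer_Suc)
next
  case (Suc N)
  let ?P = "qpochhammer (- (fps_X ^ 2)) (fps_X ^ 2) :: nat \<Rightarrow> 'a fps"
  let ?Q = "qpochhammer fps_X fps_X :: nat \<Rightarrow> 'a fps"
  let ?L = "inverse (1 - fps_X ^ (2 * N + 3)) *
       ((1 + fps_X ^ (2 * N + 2)) * inverse (1 - fps_X ^ (2 * N + 2))) :: 'a fps"
  have "((\<lambda>p. fps_X ^ (\<lambda>(u, v). (2 * N + 1) * max u v + u + v) p) has_sum ?L) UNIV"
    using has_sum_level[of N] by (simp add: case_prod_unfold)
  from has_sum_fps_X_power_Times[OF Suc.IH this]
  have "((\<lambda>(p, u, v). fps_X ^ (pair_size N p + ((2 * N + 1) * max u v + u + v))) has_sum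
      ?P N * inverse (?Q (2 * N + 1)) * ?L) (interlacing N \<times> UNIV)"
    by (simp add: case_prod_unfold)
  also have "?this \<longleftrightarrow> ((\<lambda>p. fps_X ^ pair_size (Suc N) p) has_sum
      ?P N * inverse (?Q (2 * N + 1)) * ?L) (interlacing (Suc N))"
    by (rule has_sum_reindex_bij_witness[where i = "strip_level N" and j = "add_level N"])
      (auto simp only: add_level_strip_level strip_level_add_level add_level_in strip_level_in
        pair_size_add_level split: prod.split)
  also have "?P N * inverse (?Q (2 * N + 1)) * ?L = ?P (Suc N) * inverse (?Q (2 * Suc N + 1))"
  proof -
    have "?P (Suc N) = ?P N * (1 + fps_X ^ (2 * N + 2))"
      by (simp add: qpochhammer_Suc mult.commute flip: power_mult power_add)
    moreover have "?Q (2 * Suc N + 1) =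
        ?Q (2 * N + 1) * (1 - fps_X ^ (2 * N + 2)) * (1 - fps_X ^ (2 * N + 3))"
      by (simp add: qpochhammer_Suc numeral_3_eq_3)
    ultimately show ?thesis
      by (simp only: fps_inverse_mult mult_ac)
  qed
  finally show ?case .
qed

section \<open>Partitions as sequences\<close>

lemma part_antimono:
  assumes "is_partition xs"
  shows "part xs (Suc j) \<le> part xs j"
  using assms by (auto simp: is_partition_def part_def sorted_wrt_iff_nth_less)

lemma part_pos_iff:
  assumes "is_partition xs"
  shows "part xs j > 0 \<longleftrightarrow> j < length xs"
  using assms by (auto simp: is_partition_def part_def)

lemma part_inject:
  assumes "is_partition xs" "is_partition ys" "part xs = part ys"
  shows "xs = ys"
proof (rule nth_equalityI)
  have "j < length xs \<longleftrightarrow> j < length ys" for j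
    using part_pos_iff[OF assms(1)] part_pos_iff[OF assms(2)] assms(3) by metis
  then show len: "length xs = length ys"
    by (metis nat_neq_iff)
  show "xs ! j = ys ! j" if "j < length xs" for j
    using fun_cong[OF assms(3), of j] that len by (simp add: part_def)
qed

lemma ex_partition:
  assumes dec: "\<And>j. f (Suc j) \<le> f j" and "f K = 0"
  shows "\<exists>xs. is_partition xs \<and> part xs = f"
proof -
  \<comment> \<open>The number of positive values: \<open>f\<close> is decreasing, so it vanishes
    from its first zero on.\<close>
  define L where "L = (LEAST k. f k = 0)"
  have "f L = 0"
    unfolding L_def by (rule LeastI) fact
  have antimono: "f j \<le> f i" if "i \<le> j" for i j
    using that dec by (rule lift_Suc_antimono_le[rotated])
  have "f j = 0" if "j \<ge> L" for j
    using antimono[OF that] \<open>f L = 0\<close> by simp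
  moreover have "f j > 0" if "j < L" for j
    using not_less_Least[of j "\<lambda>k. f k = 0"] that by (simp add: L_def)
  ultimately have "is_partition (map f [0..<L])" "part (map f [0..<L]) = f"
    by (auto simp: is_partition_def part_def sorted_wrt_iff_nth_less fun_eq_iff intro: antimono)
  then show ?thesis by blast
qed

lemma sum_list_eq_sum_part:
  assumes "length xs \<le> n"
  shows "sum_list xs = sum (part xs) {..<n}"
proof -
  have "sum_list xs = (\<Sum>j<length xs. part xs j)"
    by (simp add: sum_list_sum_nth atLeast0LessThan part_def)
  also have "\<dots> = (\<Sum>j<n. part xs j)"
    using assms by (intro sum.mono_neutral_left) (auto simp: part_def)
  finally show ?thesis .
qed

lemma length_le_sum_list:
  assumes "is_partition xs"
  shows "length xs \<le> sum_list xs"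
proof -
  have "\<forall>x\<in>set xs. 0 < x" using assms by (simp add: is_partition_def)
  then show ?thesis by (induction xs) auto
qed

section \<open>Cylindric partitions of profile (2, 0) as interlacing pairs\<close>

lemma cylindric_partitions_2_0:
  "cylindric_partitions [2, 0] = {[xs, ys] | xs ys. is_partition xs \<and> is_partition ys \<and>
     (\<forall>j. part ys j \<le> part xs j \<and> part xs (Suc (Suc j)) \<le> part ys j)}"
  by (auto simp: cylindric_partitions_def length_Suc_conv numeral_2_eq_2)

text \<open>Positive parts force both lengths to be at most the size \<open>n \<le> N\<close>, so
  cutting off after \<open>N\<close> levels loses nothing of size \<open>n\<close>.\<close>

lemma bij_betw_cylindric_partitions_interlacing:
  assumes "n \<le> N"
  shows "bij_betw (\<lambda>\<Lambda>. (part (\<Lambda> ! 0), part (\<Lambda> ! 1)))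
    {\<Lambda> \<in> cylindric_partitions [2, 0]. cp_size \<Lambda> = n} {p \<in> interlacing N. pair_size N p = n}"
    (is "bij_betw ?\<phi> ?C ?I")
proof -
  have inj: "inj_on ?\<phi> ?C"
    by (auto simp: inj_on_def cylindric_partitions_2_0 intro: part_inject)
  have size: "cp_size [xs, ys] = pair_size N (part xs, part ys)"
    if "length xs \<le> Suc N" "length ys \<le> N" for xs ys
    using that by (simp add: cp_size_def sum_list_eq_sum_part lessThan_Suc_atMost)
  have "?\<phi> \<Lambda> \<in> ?I" if "\<Lambda> \<in> ?C" for \<Lambda>
  proof -
    from that obtain xs ys where \<Lambda>: "\<Lambda> = [xs, ys]" and part: "is_partition xs" "is_partition ys"
      and le: "\<And>j. part ys j \<le> part xs j" "\<And>j. part xs (Suc (Suc j)) \<le> part ys j"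
      and n: "cp_size [xs, ys] = n"
      by (auto simp: cylindric_partitions_2_0)
    have len: "length xs \<le> N" "length ys \<le> N"
      using length_le_sum_list[OF part(1)] length_le_sum_list[OF part(2)] n assms
      by (auto simp: cp_size_def)
    then have "part xs (Suc N) = 0" "part ys N = 0"
      by (auto simp: part_def)
    then show ?thesis
      using le part n size[of xs ys] len by (auto simp: \<Lambda> interlacing_def part_antimono)
  qed
  moreover have "p \<in> ?\<phi> ` ?C" if "p \<in> ?I" for p
  proof -
    obtain f g where p: "p = (f, g)" by (cases p)
    have fg: "(f, g) \<in> interlacing N" and n: "pair_size N (f, g) = n"
      using that p by auto
    obtain xs where xs: "is_partition xs" "part xs = f"
      using ex_partition[of f "Suc N"] fg by (auto simp: interlacing_def)
    obtain ys where ys: "is_partition ys" "part ys = g"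
      using ex_partition[of g N] fg by (auto simp: interlacing_def)
    have "length xs \<le> Suc N" "length ys \<le> N"
      using part_pos_iff[OF xs(1), of "Suc N"] part_pos_iff[OF ys(1), of N] fg xs ys
      by (auto simp: interlacing_def)
    then have "[xs, ys] \<in> ?C"
      using size[of xs ys] n fg xs ys by (auto simp: cylindric_partitions_2_0 interlacing_def)
    then show ?thesis
      using xs ys p by force
  qed
  ultimately show ?thesis
    using inj unfolding bij_betw_def by blast
qed

theorem theorem3p2:
  shows "((\<lambda>\<Lambda>. (fps_X :: rat fps) ^ cp_size \<Lambda>) has_sum
           (qpochhammer_inf (- (fps_X ^ 2)) (fps_X ^ 2) / qpochhammer_inf fps_X fps_X))
         (cylindric_partitions [2, 0])"
proof -
  let ?P = "qpochhammer (- (fps_X ^ 2)) (fps_X ^ 2) :: nat \<Rightarrow> rat fps"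
  let ?Q = "qpochhammer fps_X fps_X :: nat \<Rightarrow> rat fps"
  let ?G = "qpochhammer_inf (- (fps_X ^ 2)) (fps_X ^ 2) / qpochhammer_inf fps_X fps_X :: rat fps"
  have P: "?P \<longlonglongrightarrow> qpochhammer_inf (- (fps_X ^ 2)) (fps_X ^ 2)"
    by (rule tendsto_qpochhammer_inf) auto
  have Q: "?Q \<longlonglongrightarrow> qpochhammer_inf fps_X fps_X"
    by (rule tendsto_qpochhammer_inf) auto
  then have "eventually (\<lambda>n. ?Q n $ 0 = qpochhammer_inf fps_X fps_X $ 0) sequentially"
    by (simp add: tendsto_fps_iff)
  then have Q0: "qpochhammer_inf fps_X fps_X $ 0 = (1 :: rat)"
    by (simp add: fps_nth_0_qpochhammer)
  \<comment> \<open>The finite denominators run only through odd indices, a subsequence with the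
    same limit.\<close>
  have "filterlim (\<lambda>N. 2 * N + 1 :: nat) sequentially sequentially"
    by (rule filterlim_subseq) (simp add: strict_mono_def)
  from filterlim_compose[OF Q this] have "(\<lambda>N. ?Q (2 * N + 1)) \<longlonglongrightarrow> qpochhammer_inf fps_X fps_X" .
  then have "(\<lambda>N. ?P N * inverse (?Q (2 * N + 1))) \<longlonglongrightarrow> ?G"
    by (subst fps_divide_unit) (auto intro!: tendsto_mult_fps tendsto_inverse_fps P simp: Q0)
  then have lim: "eventually (\<lambda>N. (?P N * inverse (?Q (2 * N + 1))) $ n = ?G $ n) sequentially" for n
    by (simp add: tendsto_fps_iff)
  show ?thesis
    unfolding has_sum_fps_X_power_iff
  proof
    fix n
    \<comment> \<open>One \<open>N\<close> serves both purposes: it is large enough for the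
      bijection in size \<open>n\<close> and for coefficient \<open>n\<close> to have reached its
      limit.\<close>
    obtain N where "N \<ge> n" and N: "(?P N * inverse (?Q (2 * N + 1))) $ n = ?G $ n"
      using eventually_happens[OF eventually_conj[OF lim[of n] eventually_ge_at_top[of n]]] by auto
    have "finite {p \<in> interlacing N. pair_size N p = n} \<and>
        ?G $ n = of_nat (card {p \<in> interlacing N. pair_size N p = n})"
      using has_sum_interlacing[of N, where 'a = rat] N unfolding has_sum_fps_X_power_iff by metis
    then show "finite {\<Lambda> \<in> cylindric_partitions [2, 0]. cp_size \<Lambda> = n} \<and>
        ?G $ n = of_nat (card {\<Lambda> \<in> cylindric_partitions [2, 0]. cp_size \<Lambda> = n})"
      using bij_betw_cylindric_partitions_interlacing[OF \<open>N \<ge> n\<close>]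
      by (simp add: bij_betw_finite bij_betw_same_card)
  qed
qed

end
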